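(* Let $\omega\neq 0$ and let $\{P_{n_1,n_2}(x)\}_{n_1+n_2=0}^{\infty}$ be a multiple polynomial set. The following assertions are equivalent: (a) $\{P_{n_1,n_2}(x)\}$ is a $\Delta_\omega$-Appell polynomial set, i.e. for all integers $n_1,n_2\ge 0$, $$\Delta_\omega P_{n_1,n_2}(x)=n_1P_{n_1-1,n_2}(x)+n_2P_{n_1,n_2-1}(x).$$ (b) $\{P_{n_1,n_2}(x)\}$ is generated by $$A(t_1,t_2)\big(1+\omega(t_1+t_2)\big)^{x/\omega}=\sum_{n_1=0}^{\infty}\sum_{n_2=0}^{\infty}P_{n_1,n_2}(x)\frac{t_1^{n_1}}{n_1!}\frac{t_2^{n_2}}{n_2!},$$ where $$A(t_1,t_2)=\sum_{n_1=0}^{\infty}\sum_{n_2=0}^{\infty}a_{n_1,n_2}\frac{t_1^{n_1}}{n_1!}\frac{t_2^{n_2}}{n_2!},\qquad a_{0,0}\neq 0,$$ for some constants $a_{n_1,n_2}$ independent of $x$. (c) There exists a sequence of constants $\{a_{n_1,n_2}\}_{n_1,n_2=0}^{\infty}$ with $a_{0,0}\neq 0$ such that for all $n_1,n_2\ge 0$ $$P_{n_1,n_2}(x)=\sum_{k_1=0}^{n_1}\sum_{k_2=0}^{n_2}\binom{n_1}{k_1}\binom{n_2}{k_2}a_{n_1-k_1,n_2-k_2}\,x^{(k_1+k_2,\omega)}.$$ (d) For all $n_1,n_2\ge 0$ the following addition formula holds: $$P_{n_1,n_2}(x+y)=\sum_{k_1=0}^{n_1}\sum_{k_2=0}^{n_2}\binom{n_1}{k_1}\binom{n_2}{k_2}P_{n_1-k_1,n_2-k_2}(x)\,y^{(k_1+k_2,\omega)}.$$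 (e) There exists a sequence of constants $\{a_{n_1,n_2}\}_{n_1,n_2=0}^{\infty}$ with $a_{0,0}\neq 0$ such that for all $n_1,n_2\ge 0$ $$P_{n_1,n_2}(x)=\sum_{k_1=0}^{n_1}\sum_{k_2=0}^{n_2}\binom{n_1}{k_1}\binom{n_2}{k_2}\frac{(n_1+n_2-k_1-k_2)!}{(n_1+n_2)!}\,a_{k_1,k_2}\,\Delta_\omega^{k_1+k_2}x^{(n_1+n_2,\omega)}.$$
   Context: For $\omega\ne 0$, $\Delta_\omega f(x)=\dfrac{f(x+\omega)-f(x)}{\omega}$, and $\Delta_\omega^k$ denotes its $k$-th iterate (acting on the variable $x$). For an integer $n\ge 1$, $x^{(n,\omega)}=x(x-\omega)(x-2\omega)\cdots(x-(n-1)\omega)$, and $x^{(0,\omega)}=1$. A multiple polynomial set $\{P_{n_1,n_2}(x)\}_{n_1+n_2=0}^\infty$ is a family of polynomials in $x$ (real coefficients, $\omega$ real) indexed by pairs of nonnegative integers, with $P_{n_1,n_2}$ of degree exactly $n_1+n_2$ (in particular $P_{0,0}$ is a nonzero constant). Terms $n_1P_{n_1-1,n_2}$ with $n_1=0$ and $n_2P_{n_1,n_2-1}$ with $n_2=0$ are understood to be $0$. Generating functions are identities of formal power series in $t_1,t_2$, where $(1+\omega(t_1+t_2))^{x/\omega}$ stands for $\sum_{k\ge 0}x^{(k,\omega)}\frac{(t_1+t_2)^k}{k!}$. *)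

theory Defs
  imports Complex_Main "HOL-Computational_Algebra.Computational_Algebra"
begin

definition fwd_diff :: "real \<Rightarrow> (real \<Rightarrow> real) \<Rightarrow> (real \<Rightarrow> real)" where
  "fwd_diff \<omega> f = (\<lambda>x. (f (x + \<omega>) - f x) / \<omega>)"

definition ffact_step :: "real \<Rightarrow> nat \<Rightarrow> real \<Rightarrow> real" where
  "ffact_step \<omega> n x = (\<Prod>i<n. x - real i * \<omega>)"

text \<open>
  The condition \<open>P n1 n2 \<noteq> 0\<close> only matters for \<open>n1 = n2 = 0\<close>, since \<open>degree 0 = 0\<close>.
\<close>

definition multiple_polynomial_set :: "(nat \<Rightarrow> nat \<Rightarrow> real poly) \<Rightarrow> bool" where
  "multiple_polynomial_set P \<longleftrightarrow>
     (\<forall>n1 n2. P n1 n2 \<noteq> 0 \<and> degree (P n1 n2) = n1 + n2)"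

text \<open>
  For \<open>n1 = 0\<close> or \<open>n2 = 0\<close> the truncated index is harmless: its factor is \<open>0\<close>.
\<close>

definition delta_appell :: "real \<Rightarrow> (nat \<Rightarrow> nat \<Rightarrow> real poly) \<Rightarrow> bool" where
  "delta_appell \<omega> P \<longleftrightarrow>
     (\<forall>n1 n2 x. fwd_diff \<omega> (poly (P n1 n2)) x =
        real n1 * poly (P (n1 - 1) n2) x + real n2 * poly (P n1 (n2 - 1)) x)"

text \<open>
  Formal power series in \<open>t1\<close>, \<open>t2\<close> are elements of \<open>real fps fps\<close>, where \<open>t1\<close> is the
  variable of the inner and \<open>t2\<close> that of the outer series: the coefficient of
  \<open>t1 ^ i * t2 ^ j\<close> in \<open>F\<close> is \<open>F $ j $ i\<close>.
\<close>

definition t1 :: "real fps fps" where "t1 = fps_const fps_X"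

definition t2 :: "real fps fps" where "t2 = fps_X"

definition egf2 :: "(nat \<Rightarrow> nat \<Rightarrow> real) \<Rightarrow> real fps fps" where
  "egf2 a = Abs_fps (\<lambda>n2. Abs_fps (\<lambda>n1. a n1 n2 / (fact n1 * fact n2)))"

text \<open>
  Coefficientwise sum of a family in which every monomial occurs only finitely often.
  Neither the library's topology on \<open>real fps fps\<close> nor \<open>fps_compose\<close> can be used to
  substitute \<open>t1 + t2\<close> into a series: the former is discrete in the inner series, and
  \<open>t1 + t2\<close> has the nonzero constant term \<open>fps_X\<close> as a series in \<open>t2\<close>.
\<close>

definition formal_sum2 :: "(nat \<Rightarrow> real fps fps) \<Rightarrow> real fps fps" where
  "formal_sum2 F =
     Abs_fps (\<lambda>j. Abs_fps (\<lambda>i. \<Sum>k | F k $ j $ i \<noteq> 0. F k $ j $ i))"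

text \<open>The series \<open>(1 + \<omega> (t1 + t2)) powr (x / \<omega>)\<close>, read formally.\<close>

definition binomial_series2 :: "real \<Rightarrow> real \<Rightarrow> real fps fps" where
  "binomial_series2 \<omega> x =
     formal_sum2 (\<lambda>k. fps_const (fps_const (ffact_step \<omega> k x / fact k)) * (t1 + t2) ^ k)"

lemma t1_plus_t2_power_nth:
  "(t1 + t2) ^ k $ j $ i = (if i + j = k then real (k choose j) else 0)"
proof -
  have *: "(t1 + t2) ^ k = (\<Sum>m\<le>k. of_nat (k choose m) * t2 ^ m * t1 ^ (k - m))"
    by (subst add.commute) (rule binomial_ring)
  have "(of_nat (k choose m) * t2 ^ m * t1 ^ (k - m)) $ j $ i =
        (if m = j then if i = k - m then real (k choose m) else 0 else 0)" for m
  proof -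
    have "of_nat (k choose m) * t2 ^ m * t1 ^ (k - m) =
        fps_const (fps_const (real (k choose m)) * fps_X ^ (k - m)) * fps_X ^ m"
      by (simp add: t1_def t2_def fps_of_nat fps_const_power mult_ac
          flip: fps_const_mult fps_of_nat)
    then show ?thesis
      by (auto simp: fps_X_power_nth)
  qed
  then show ?thesis
    by (auto simp: * fps_sum_nth sum.delta)
qed

text \<open>In particular the formal sum above is a genuine one: each monomial occurs at most once.\<close>

lemma binomial_series2_eq_egf2:
  "binomial_series2 \<omega> x = egf2 (\<lambda>n1 n2. ffact_step \<omega> (n1 + n2) x)"
proof -
  define F where
    "F k = fps_const (fps_const (ffact_step \<omega> k x / fact k)) * (t1 + t2) ^ k" for k
  have F: "F k $ j $ i = (if k = i + j then ffact_step \<omega> k x / (fact i * fact j) else 0)"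
    for i j k
    by (auto simp: F_def t1_plus_t2_power_nth binomial_fact field_simps)
  have "(\<Sum>k | F k $ j $ i \<noteq> 0. F k $ j $ i) = (\<Sum>k\<in>{i + j}. F k $ j $ i)" for i j
    by (rule sum.mono_neutral_left) (auto simp: F)
  then show ?thesis
    unfolding binomial_series2_def formal_sum2_def egf2_def F_def[symmetric]
    by (simp add: F)
qed

end

theory Submission
  imports Defs
begin

text \<open>
  Write \<open>G x\<close> for the generating function of \<open>P\<close> at \<open>x\<close>, \<open>E x\<close> for the binomial series
  and \<open>s = t1 + t2\<close>. The Appell property says precisely that
  \<open>G (x + \<omega>) = (1 + \<omega> s) * G x\<close>. Since \<open>E\<close> has this property and \<open>E 0 = 1\<close>, both
  \<open>G (x + m \<omega>)\<close> and \<open>G x * E (m \<omega>)\<close> equal \<open>(1 + \<omega> s) ^ m * G x\<close> for every natural \<open>m\<close>.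
  Coefficientwise, \<open>G (x + y) = G x * E y\<close> is an identity between polynomials in \<open>y\<close>, so it
  holds for all \<open>y\<close>; this is the addition formula (d), and \<open>x = 0\<close> gives (c), which is (b)
  read coefficientwise. As (b) says that \<open>G x\<close> is \<open>E x\<close> times a series independent of \<open>x\<close>,
  it yields the Appell property back. Finally, (e) is (c) after the reversal
  \<open>k \<mapsto> n - k\<close>, because the \<open>k\<close>-th difference of \<open>x\<^bsup>(n,\<omega>)\<^esup>\<close> is \<open>n! / (n - k)! x\<^bsup>(n-k,\<omega>)\<^esup>\<close>.
\<close>

lemma egf2_eq_iff: "egf2 a = egf2 b \<longleftrightarrow> (\<forall>n1 n2. a n1 n2 = b n1 n2)"
  by (auto simp: egf2_def fps_eq_iff)

text \<open>The factorials turn the Cauchy product into a binomial convolution. The complementary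
  indices stand on \<open>a\<close>, so that with \<open>b\<close> coming from
  \<open>binomial_series2\<close> this is the sum in (c) and (d).\<close>

lemma egf2_mult:
  "egf2 a * egf2 b =
     egf2 (\<lambda>n1 n2. \<Sum>k1=0..n1. \<Sum>k2=0..n2. real (n1 choose k1) * real (n2 choose k2) *
       a (n1 - k1) (n2 - k2) * b k1 k2)"
proof -
  \<comment> \<open>The factors are exchanged because \<open>fps_mult_nth\<close> puts the running
    index on the left factor.\<close>
  have "(egf2 b * egf2 a) $ n2 $ n1 =
      (\<Sum>k1=0..n1. \<Sum>k2=0..n2. real (n1 choose k1) * real (n2 choose k2) *
        a (n1 - k1) (n2 - k2) * b k1 k2) / (fact n1 * fact n2)" for n1 n2
  proof -
    have "(egf2 b * egf2 a) $ n2 $ n1 =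
        (\<Sum>k2=0..n2. \<Sum>k1=0..n1. b k1 k2 / (fact k1 * fact k2) *
          (a (n1 - k1) (n2 - k2) / (fact (n1 - k1) * fact (n2 - k2))))"
      by (simp add: egf2_def fps_mult_nth fps_sum_nth)
    also have "\<dots> = (\<Sum>k1=0..n1. \<Sum>k2=0..n2. b k1 k2 / (fact k1 * fact k2) *
          (a (n1 - k1) (n2 - k2) / (fact (n1 - k1) * fact (n2 - k2))))"
      by (rule sum.swap)
    also have "\<dots> = (\<Sum>k1=0..n1. \<Sum>k2=0..n2. real (n1 choose k1) * real (n2 choose k2) *
        a (n1 - k1) (n2 - k2) * b k1 k2 / (fact n1 * fact n2))"
      by (intro sum.cong refl) (simp add: binomial_fact mult_ac)
    finally show ?thesis
      by (simp add: sum_divide_distrib)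
  qed
  then show ?thesis
    by (subst mult.commute) (simp add: fps_eq_iff egf2_def)
qed

text \<open>Multiplying by \<open>t1\<close> shifts the first index, and rescaling by
  \<open>fact n1\<close> leaves the factor \<open>n1\<close>, which is zero exactly where
  \<open>n1 - 1\<close> is truncated; likewise for \<open>t2\<close>. This yields the right-hand
  side of the Appell property.\<close>

lemma t1_plus_t2_mult_egf2:
  "(t1 + t2) * egf2 f =
     egf2 (\<lambda>n1 n2. real n1 * f (n1 - 1) n2 + real n2 * f n1 (n2 - 1))"
proof -
  have 1: "(t1 * egf2 f) $ n2 $ n1 = real n1 * f (n1 - 1) n2 / (fact n1 * fact n2)" for n1 n2
    by (cases n1) (simp_all add: t1_def egf2_def divide_simps)
  have 2: "(t2 * egf2 f) $ n2 $ n1 = real n2 * f n1 (n2 - 1) / (fact n1 * fact n2)" for n1 n2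
    by (cases n2) (simp_all add: t2_def egf2_def divide_simps)
  show ?thesis
    by (simp add: fps_eq_iff distrib_right 1 2 add_divide_distrib) (simp add: egf2_def add_divide_distrib)
qed

lemma shift_factor_mult_egf2:
  "(1 + fps_const (fps_const \<omega>) * (t1 + t2)) * egf2 f =
     egf2 (\<lambda>n1 n2. f n1 n2 + \<omega> * (real n1 * f (n1 - 1) n2 + real n2 * f n1 (n2 - 1)))"
proof -
  have "(1 + fps_const (fps_const \<omega>) * (t1 + t2)) * egf2 f =
      egf2 f + fps_const (fps_const \<omega>) * ((t1 + t2) * egf2 f)"
    by (simp only: distrib_right mult_1 mult.assoc)
  then show ?thesis
    unfolding t1_plus_t2_mult_egf2
    by (simp add: fps_eq_iff egf2_def add_divide_distrib distrib_left)
qed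

lemma delta_appell_iff_egf2:
  assumes "\<omega> \<noteq> 0"
  shows "delta_appell \<omega> P \<longleftrightarrow>
    (\<forall>x. egf2 (\<lambda>n1 n2. poly (P n1 n2) (x + \<omega>)) =
      (1 + fps_const (fps_const \<omega>) * (t1 + t2)) * egf2 (\<lambda>n1 n2. poly (P n1 n2) x))"
proof -
  have "(u - v) / \<omega> = w \<longleftrightarrow> u = v + \<omega> * w" for u v w
    using assms by (auto simp: field_simps)
  then show ?thesis
    unfolding delta_appell_def fwd_diff_def shift_factor_mult_egf2 egf2_eq_iff by blast
qed

lemma ffact_step_Suc: "ffact_step \<omega> (Suc n) x = ffact_step \<omega> n x * (x - real n * \<omega>)"
  by (simp add: ffact_step_def)

lemma ffact_step_Suc_shift: "ffact_step \<omega> (Suc n) (x + \<omega>) = (x + \<omega>) * ffact_step \<omega> n x"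
  by (simp add: ffact_step_def prod.lessThan_Suc_shift algebra_simps del: prod.lessThan_Suc)

text \<open>For \<open>n = m + 1\<close> both values share the factor
  \<open>ffact_step \<omega> m x\<close>; the remaining factors \<open>x + \<omega>\<close> and
  \<open>x - m * \<omega>\<close> differ by \<open>n * \<omega>\<close>.\<close>

lemma ffact_step_shift:
  "ffact_step \<omega> n (x + \<omega>) = ffact_step \<omega> n x + \<omega> * (real n * ffact_step \<omega> (n - 1) x)"
proof (cases n)
  case 0
  then show ?thesis by (simp add: ffact_step_def)
next
  case (Suc m)
  then show ?thesis
    using ffact_step_Suc[of \<omega> m x] ffact_step_Suc_shift[of \<omega> m x] by (simp add: algebra_simps)
qed

lemma binomial_series2_0: "binomial_series2 \<omega> 0 = 1"
proof -
  have "ffact_step \<omega> n 0 = (if n = 0 then 1 else 0)" for n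
    by (auto simp: ffact_step_def)
  then show ?thesis
    by (auto simp: binomial_series2_eq_egf2 egf2_def fps_eq_iff fps_one_nth)
qed

lemma binomial_series2_shift:
  "binomial_series2 \<omega> (x + \<omega>) =
     (1 + fps_const (fps_const \<omega>) * (t1 + t2)) * binomial_series2 \<omega> x"
proof -
  \<comment> \<open>The index \<open>n1 - 1 + n2\<close> can differ from \<open>n1 + n2 - 1\<close>
    only if \<open>n1 = 0\<close>, where its coefficient vanishes; the same holds for
    \<open>n2\<close>.\<close>
  have "real (n1 + n2) * ffact_step \<omega> (n1 + n2 - 1) x =
      real n1 * ffact_step \<omega> (n1 - 1 + n2) x + real n2 * ffact_step \<omega> (n1 + (n2 - 1)) x"
    for n1 n2
    by (cases n1; cases n2) (simp_all add: algebra_simps)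
  then show ?thesis
    unfolding binomial_series2_eq_egf2 shift_factor_mult_egf2 egf2_eq_iff ffact_step_shift
    by (simp only: simp_thms)
qed

lemma iterate_shift:
  fixes G :: "'a::semiring_1 \<Rightarrow> 'b::monoid_mult"
  assumes "\<And>x. G (x + \<omega>) = c * G x"
  shows "G (x + of_nat m * \<omega>) = c ^ m * G x"
proof (induction m)
  case (Suc m)
  have "G (x + of_nat (Suc m) * \<omega>) = G (x + of_nat m * \<omega> + \<omega>)"
    by (simp add: algebra_simps)
  with Suc assms show ?case by (simp add: mult.assoc)
qed simp

text \<open>As \<open>\<omega> \<noteq> 0\<close>, the multiples are infinitely many distinct roots
  of \<open>p - q\<close>.\<close>

lemma poly_eq_on_multiples:
  fixes p q :: "real poly"
  assumes "\<omega> \<noteq> 0" and eq: "\<And>m :: nat. poly p (real m * \<omega>) = poly q (real m * \<omega>)"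
  shows "p = q"
proof (rule ccontr)
  assume "p \<noteq> q"
  then have "finite {y. poly (p - q) y = 0}"
    by (intro poly_roots_finite) simp
  moreover have "range (\<lambda>m. real m * \<omega>) \<subseteq> {y. poly (p - q) y = 0}"
    using eq by auto
  moreover have "infinite (range (\<lambda>m. real m * \<omega>))"
    using \<open>\<omega> \<noteq> 0\<close> by (intro range_inj_infinite) (simp add: inj_on_def)
  ultimately show False
    using finite_subset by blast
qed

lemma delta_appell_addition:
  assumes \<omega>: "\<omega> \<noteq> 0" and P: "delta_appell \<omega> P"
  shows "poly (P n1 n2) (x + y) =
    (\<Sum>k1=0..n1. \<Sum>k2=0..n2. real (n1 choose k1) * real (n2 choose k2) *
      poly (P (n1 - k1) (n2 - k2)) x * ffact_step \<omega> (k1 + k2) y)"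
proof -
  define G where "G x = egf2 (\<lambda>n1 n2. poly (P n1 n2) x)" for x
  define c where "c = 1 + fps_const (fps_const \<omega>) * (t1 + t2)"
  have "G (x + real m * \<omega>) = G x * binomial_series2 \<omega> (real m * \<omega>)" for m
  proof -
    have "G (x + real m * \<omega>) = c ^ m * G x"
      using P by (intro iterate_shift) (simp add: G_def c_def delta_appell_iff_egf2[OF \<omega>])
    moreover have "binomial_series2 \<omega> (0 + real m * \<omega>) = c ^ m * binomial_series2 \<omega> 0"
      by (rule iterate_shift) (simp add: c_def binomial_series2_shift)
    ultimately show ?thesis
      by (simp add: binomial_series2_0 mult.commute)
  qed
  then have *: "poly (P n1 n2) (x + real m * \<omega>) =
      (\<Sum>k1=0..n1. \<Sum>k2=0..n2. real (n1 choose k1) * real (n2 choose k2) *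
        poly (P (n1 - k1) (n2 - k2)) x * ffact_step \<omega> (k1 + k2) (real m * \<omega>))" for m
    by (simp add: G_def binomial_series2_eq_egf2 egf2_mult egf2_eq_iff)
  \<comment> \<open>With \<open>x\<close> fixed, \<open>L\<close> and \<open>R\<close> are the two
    sides of the addition formula as polynomials in \<open>y\<close>.\<close>
  define L where "L = pcompose (P n1 n2) [:x, 1:]"
  define R where "R = (\<Sum>k1=0..n1. \<Sum>k2=0..n2. smult (real (n1 choose k1) * real (n2 choose k2) *
      poly (P (n1 - k1) (n2 - k2)) x) (\<Prod>i<k1 + k2. [:- (real i * \<omega>), 1:]))"
  have L: "poly L z = poly (P n1 n2) (x + z)" for z
    by (simp add: L_def poly_pcompose)
  have R: "poly R z = (\<Sum>k1=0..n1. \<Sum>k2=0..n2. real (n1 choose k1) * real (n2 choose k2) *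
      poly (P (n1 - k1) (n2 - k2)) x * ffact_step \<omega> (k1 + k2) z)" for z
    by (simp add: R_def poly_sum poly_prod ffact_step_def)
  have "L = R"
    using \<omega> * by (intro poly_eq_on_multiples) (simp_all only: L R)
  with L[of y] R[of y] show ?thesis by simp
qed

text \<open>Each difference lowers the index by one and contributes the old index as a factor. For
  \<open>k > n\<close> the difference is zero, whereas truncated subtraction would give
  \<open>fact n\<close>.\<close>

lemma fwd_diff_power_ffact_step:
  assumes "\<omega> \<noteq> 0" and "k \<le> n"
  shows "(fwd_diff \<omega> ^^ k) (ffact_step \<omega> n) =
    (\<lambda>x. fact n / fact (n - k) * ffact_step \<omega> (n - k) x)"
  using \<open>k \<le> n\<close>
proof (induction k)
  case (Suc k)
  define m where "m = n - Suc k"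
  have m: "n - k = Suc m"
    using Suc.prems by (simp add: m_def)
  have "(fwd_diff \<omega> ^^ Suc k) (ffact_step \<omega> n) x = fact n / fact m * ffact_step \<omega> m x" for x
  proof -
    have "(fwd_diff \<omega> ^^ Suc k) (ffact_step \<omega> n) x =
        fwd_diff \<omega> (\<lambda>x. fact n / fact (Suc m) * ffact_step \<omega> (Suc m) x) x"
      using Suc m by simp
    also have "\<dots> = fact n / fact (Suc m) * (real (Suc m) * ffact_step \<omega> m x)"
      using assms(1)
      by (simp add: fwd_diff_def ffact_step_shift distrib_left diff_divide_distrib
          add_divide_distrib del: of_nat_Suc fact_Suc)
    finally show ?thesis
      by (simp del: of_nat_Suc)
  qed
  then show ?case
    by (simp add: m_def fun_eq_iff)
qed simp

lemma explicit_sum_eq_fwd_diff_sum: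
  assumes "\<omega> \<noteq> 0"
  shows "(\<Sum>k1=0..n1. \<Sum>k2=0..n2. real (n1 choose k1) * real (n2 choose k2) *
      a (n1 - k1) (n2 - k2) * ffact_step \<omega> (k1 + k2) x) =
    (\<Sum>k1=0..n1. \<Sum>k2=0..n2. real (n1 choose k1) * real (n2 choose k2) *
      (fact (n1 + n2 - k1 - k2) / fact (n1 + n2)) * a k1 k2 *
      (fwd_diff \<omega> ^^ (k1 + k2)) (ffact_step \<omega> (n1 + n2)) x)"
proof -
  have "(\<Sum>k1=0..n1. \<Sum>k2=0..n2. real (n1 choose k1) * real (n2 choose k2) *
      a (n1 - k1) (n2 - k2) * ffact_step \<omega> (k1 + k2) x) =
    (\<Sum>k1=0..n1. \<Sum>k2=0..n2. real (n1 choose (n1 - k1)) * real (n2 choose (n2 - k2)) *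
      a (n1 - (n1 - k1)) (n2 - (n2 - k2)) * ffact_step \<omega> (n1 - k1 + (n2 - k2)) x)"
    by (subst sum.atLeastAtMost_rev, subst (2) sum.atLeastAtMost_rev) simp
  also have "\<dots> = (\<Sum>k1=0..n1. \<Sum>k2=0..n2. real (n1 choose k1) * real (n2 choose k2) *
      (fact (n1 + n2 - k1 - k2) / fact (n1 + n2)) * a k1 k2 *
      (fwd_diff \<omega> ^^ (k1 + k2)) (ffact_step \<omega> (n1 + n2)) x)"
  proof (intro sum.cong refl)
    fix k1 k2
    assume "k1 \<in> {0..n1}" "k2 \<in> {0..n2}"
    moreover from this have "n1 - k1 + (n2 - k2) = n1 + n2 - (k1 + k2)"
      by simp
    ultimately show "real (n1 choose (n1 - k1)) * real (n2 choose (n2 - k2)) *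
        a (n1 - (n1 - k1)) (n2 - (n2 - k2)) * ffact_step \<omega> (n1 - k1 + (n2 - k2)) x =
      real (n1 choose k1) * real (n2 choose k2) *
        (fact (n1 + n2 - k1 - k2) / fact (n1 + n2)) * a k1 k2 *
        (fwd_diff \<omega> ^^ (k1 + k2)) (ffact_step \<omega> (n1 + n2)) x"
      using assms
      by (simp add: fwd_diff_power_ffact_step binomial_symmetric[symmetric])
  qed
  finally show ?thesis .
qed

theorem theorem14:
  fixes \<omega> :: real and P :: "nat \<Rightarrow> nat \<Rightarrow> real poly"
  assumes "\<omega> \<noteq> 0" and "multiple_polynomial_set P"
  shows
    "(delta_appell \<omega> P \<longleftrightarrow>
       (\<exists>a :: nat \<Rightarrow> nat \<Rightarrow> real. a 0 0 \<noteq> 0 \<and>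
         (\<forall>x. egf2 a * binomial_series2 \<omega> x = egf2 (\<lambda>n1 n2. poly (P n1 n2) x)))) \<and>
     (delta_appell \<omega> P \<longleftrightarrow>
       (\<exists>a :: nat \<Rightarrow> nat \<Rightarrow> real. a 0 0 \<noteq> 0 \<and>
         (\<forall>n1 n2 x. poly (P n1 n2) x =
           (\<Sum>k1=0..n1. \<Sum>k2=0..n2. real (n1 choose k1) * real (n2 choose k2) *
             a (n1 - k1) (n2 - k2) * ffact_step \<omega> (k1 + k2) x)))) \<and>
     (delta_appell \<omega> P \<longleftrightarrow>
       (\<forall>n1 n2 x y. poly (P n1 n2) (x + y) =
         (\<Sum>k1=0..n1. \<Sum>k2=0..n2. real (n1 choose k1) * real (n2 choose k2) *
           poly (P (n1 - k1) (n2 - k2)) x * ffact_step \<omega> (k1 + k2) y))) \<and>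
     (delta_appell \<omega> P \<longleftrightarrow>
       (\<exists>a :: nat \<Rightarrow> nat \<Rightarrow> real. a 0 0 \<noteq> 0 \<and>
         (\<forall>n1 n2 x. poly (P n1 n2) x =
           (\<Sum>k1=0..n1. \<Sum>k2=0..n2. real (n1 choose k1) * real (n2 choose k2) *
             (fact (n1 + n2 - k1 - k2) / fact (n1 + n2)) * a k1 k2 *
             (fwd_diff \<omega> ^^ (k1 + k2)) (ffact_step \<omega> (n1 + n2)) x))))"
  (is "(?A \<longleftrightarrow> ?B) \<and> (?A \<longleftrightarrow> ?C) \<and> (?A \<longleftrightarrow> ?D) \<and> (?A \<longleftrightarrow> ?E)")
proof -
  have AD: "?D" if "?A"
    using delta_appell_addition[OF assms(1) that] by blast
  have DC: "?C" if "?D"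
  \<comment> \<open>The constants are the values at 0, since (d) is read at \<open>x = 0\<close>;
    \<open>a 0 0\<close> is nonzero because \<open>P 0 0\<close> is a nonzero constant.\<close>
  proof (rule exI[of _ "\<lambda>n1 n2. poly (P n1 n2) 0"], intro conjI allI)
    have "degree (P 0 0) = 0" "P 0 0 \<noteq> 0"
      using assms(2) by (auto simp: multiple_polynomial_set_def)
    then show "poly (P 0 0) 0 \<noteq> 0"
      by (metis degree_eq_zeroE pCons_0_0 poly_const_conv)
    show "poly (P n1 n2) x =
        (\<Sum>k1=0..n1. \<Sum>k2=0..n2. real (n1 choose k1) * real (n2 choose k2) *
          poly (P (n1 - k1) (n2 - k2)) 0 * ffact_step \<omega> (k1 + k2) x)" for n1 n2 x
      using that[rule_format, of n1 n2 0 x] by simp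
  qed
  have BC: "?B \<longleftrightarrow> ?C"
    unfolding binomial_series2_eq_egf2 egf2_mult egf2_eq_iff
    by (intro iff_exI conj_cong refl iffI allI; elim allE; erule sym)
  have BA: "?A" if "?B"
  proof -
    from that obtain a where
      a: "\<And>x. egf2 (\<lambda>n1 n2. poly (P n1 n2) x) = egf2 a * binomial_series2 \<omega> x"
      by metis
    show ?thesis
      by (simp add: delta_appell_iff_egf2[OF assms(1)] a binomial_series2_shift mult_ac)
  qed
  \<comment> \<open>The same family \<open>a\<close> serves on both sides, so (e) is attached to the
    cycle (a), (d), (c), (b), (a) at (c).\<close>
  have "?C \<longleftrightarrow> ?E"
    by (simp only: explicit_sum_eq_fwd_diff_sum[OF assms(1)])
  with AD DC BC BA show ?thesis
    by blast
qed

end
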